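(* Let $\lambda\in(0,1/2)$ and let $\beta_-\le\beta_+$ be such that $\beta_+\ge \frac{10}{\lambda}$ and $\beta_-\ge(1-\lambda)\beta_+$. Let $G=(L,R,E)$ be any bipartite graph, and suppose: (i) $H$ is a subgraph of $G$ such that for every edge $(u,v)\in H$, $\deg_H(u)+\deg_H(v)\le\beta_+$; and (ii) $U$ is the set of all edges $(u,v)$ of $G$ not in $H$ such that $\deg_H(u)+\deg_H(v)<\beta_-$. Then for every $\delta\in(0,1)$, either $$\mu(H)\ge(1-4\lambda)\Big(\frac23-\delta\Big)\mu(G)\quad\text{or}\quad \mu(H\cup U)\ge(1-2\lambda)\Big(\frac23+\frac{\delta^2}{18}\Big)\mu(G).$$
   Context: For a graph $X$, $\deg_X(v)$ is the degree of vertex $v$ in $X$ and $\mu(X)$ is the maximum size (number of edges) of a matching in $X$. $H\cup U$ denotes the subgraph on the same vertex set with edge set the union of the edges of $H$ and $U$. *)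

theory Defs
  imports Complex_Main
begin

text \<open>
  Undirected edges are two-element vertex sets. Every graph in play (a bipartite graph and its
  subgraphs on the same vertex set) is represented by its edge set, since degrees and matchings
  do not depend on isolated vertices.
\<close>

definition bipartite_graph :: "'a set \<Rightarrow> 'a set \<Rightarrow> 'a set set \<Rightarrow> bool" where
  "bipartite_graph L R E \<longleftrightarrow>
     finite L \<and> finite R \<and> L \<inter> R = {} \<and> (\<forall>e\<in>E. \<exists>u\<in>L. \<exists>v\<in>R. e = {u, v})"

definition deg :: "'a set set \<Rightarrow> 'a \<Rightarrow> nat" where
  "deg X v = card {e \<in> X. v \<in> e}"

definition matching_in :: "'a set set \<Rightarrow> 'a set set \<Rightarrow> bool" where
  "matching_in X M \<longleftrightarrow> M \<subseteq> X \<and> pairwise disjnt M"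

text \<open>Meaningful for finite edge sets only, which \<open>bipartite_graph\<close> guarantees.\<close>

definition \<mu> :: "'a set set \<Rightarrow> nat" where
  "\<mu> X = Max (card ` {M. matching_in X M})"

end

theory Submission
  imports Defs
begin

text \<open>
  Let \<open>C\<close> and \<open>K\<close> be vertex covers of \<open>H \<union> U\<close> and \<open>H\<close> of sizes \<open>\<mu> (H \<union> U)\<close> and \<open>\<mu> H\<close>, which
  exist by Koenig's theorem. At least \<open>\<mu> E - card C\<close> edges of a maximum matching miss \<open>C\<close>; they lie
  outside \<open>H \<union> U\<close>, so their endpoints, which form a set \<open>S\<close>, have large total degree in \<open>H\<close>, and
  all \<open>H\<close>-edges at \<open>S\<close> lead to \<open>C\<close>. Let \<open>F\<close> be the set of these edges. Summing the edge degree
  bound over \<open>F\<close> bounds the second moment of the degrees, so that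
  \<open>V = (\<Sum>w\<in>S \<union> C. (deg F w - \<beta>\<^sub>p/2)\<^sup>2)\<close> is small unless \<open>C\<close> is large: if \<open>card C\<close> is close to
  \<open>2/3 * \<mu> E\<close>, then \<open>F\<close> is nearly \<open>\<beta>\<^sub>p/2\<close>-regular. But \<open>K\<close> covers \<open>F\<close>, and by Cauchy-Schwarz
  it covers at most \<open>card K * \<beta>\<^sub>p/2 + sqrt (card K * V)\<close> edges, which forces \<open>card K\<close> to be
  close to \<open>2/3 * \<mu> E\<close>.
\<close>

section \<open>Vertex covers and Koenig's theorem\<close>

text \<open>Finiteness is included because \<open>card\<close> is 0 on infinite sets, where a bound
  on the size of a cover would say nothing.\<close>

definition vertex_cover :: "'a set set \<Rightarrow> 'a set \<Rightarrow> bool" where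
  "vertex_cover X C \<longleftrightarrow> finite C \<and> (\<forall>e\<in>X. e \<inter> C \<noteq> {})"

lemma bipartite_graph_subset:
  "bipartite_graph L R E \<Longrightarrow> F \<subseteq> E \<Longrightarrow> bipartite_graph L R F"
  unfolding bipartite_graph_def by blast

lemma bipartite_graph_finite:
  assumes "bipartite_graph L R E"
  shows "finite E"
proof (rule finite_subset)
  show "E \<subseteq> Pow (L \<union> R)" using assms unfolding bipartite_graph_def by fastforce
  show "finite (Pow (L \<union> R))" using assms unfolding bipartite_graph_def by simp
qed

lemma bipartite_graph_card_edge:
  assumes "bipartite_graph L R E" "e \<in> E"
  shows "card e = 2"
proof -
  obtain u v where "u \<in> L" "v \<in> R" "e = {u, v}"
    using assms unfolding bipartite_graph_def by blast
  moreover have "L \<inter> R = {}" using assms(1) unfolding bipartite_graph_def by blast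
  ultimately have "u \<noteq> v" by blast
  then show ?thesis using \<open>e = {u, v}\<close> by simp
qed

text \<open>
  Lovasz's argument: if \<open>C1\<close> and \<open>C2\<close> cover all edges but \<open>e1\<close> and \<open>e2\<close>, respectively, where
  \<open>x \<in> e1 \<inter> e2\<close>, then every edge missing \<open>C1 \<inter> C2\<close> lies inside \<open>W\<close>, the symmetric difference
  of \<open>C1\<close> and \<open>C2\<close> together with \<open>x\<close>, so the smaller side of \<open>W\<close> completes \<open>C1 \<inter> C2\<close> to a cover.
\<close>

lemma konig:
  assumes "bipartite_graph L R E"
  shows "\<exists>M C. matching_in E M \<and> vertex_cover E C \<and> card C \<le> card M"
  using bipartite_graph_finite[OF assms] assms
proof (induction E rule: finite_psubset_induct)
  case (psubset E)
  show ?case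
  proof (cases "pairwise disjnt E")
    case True
    \<comment> \<open>An edge set that is itself a matching is covered by one chosen vertex per
      edge.\<close>
    define C where "C = (\<lambda>e. SOME x. x \<in> e) ` E"
    have "e \<inter> C \<noteq> {}" if "e \<in> E" for e
    proof -
      have "e \<noteq> {}" using bipartite_graph_card_edge[OF psubset.prems that] by auto
      then have "(SOME x. x \<in> e) \<in> e" by (simp add: some_in_eq)
      then show ?thesis using that unfolding C_def by blast
    qed
    moreover have "card C \<le> card E" "finite C"
      unfolding C_def using psubset.hyps by (auto intro: card_image_le)
    ultimately show ?thesis
      using True unfolding matching_in_def vertex_cover_def by blast
  next
    case False
    then obtain e1 e2 x where e: "e1 \<in> E" "e2 \<in> E" "e1 \<noteq> e2" "x \<in> e1" "x \<in> e2"
      unfolding pairwise_def disjnt_def by blast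
    have IH: "\<exists>M C. matching_in E M \<and> vertex_cover (E - {e}) C \<and> card C \<le> card M"
      if "e \<in> E" for e
    proof -
      have "\<exists>M C. matching_in (E - {e}) M \<and> vertex_cover (E - {e}) C \<and> card C \<le> card M"
        using psubset.IH[of "E - {e}"] bipartite_graph_subset[OF psubset.prems] that by blast
      then show ?thesis unfolding matching_in_def by blast
    qed
    obtain M1 C1 where 1: "matching_in E M1" "vertex_cover (E - {e1}) C1" "card C1 \<le> card M1"
      using IH[OF e(1)] by blast
    obtain M2 C2 where 2: "matching_in E M2" "vertex_cover (E - {e2}) C2" "card C2 \<le> card M2"
      using IH[OF e(2)] by blast
    show ?thesis
    proof (cases "e1 \<inter> C1 \<noteq> {} \<or> e2 \<inter> C2 \<noteq> {}")
      case True
      then have "vertex_cover E C1 \<or> vertex_cover E C2"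
        using 1 2 unfolding vertex_cover_def by blast
      then show ?thesis using 1 2 by blast
    next
      case False
      define D where "D = (C1 - C2) \<union> (C2 - C1)"
      define W where "W = insert x D"
      have fin: "finite C1" "finite C2" "finite D"
        using 1 2 unfolding vertex_cover_def D_def by auto
      have x: "x \<notin> C1" "x \<notin> C2" using False e by auto
      have cover: "vertex_cover E (C1 \<inter> C2 \<union> A \<inter> W)" if A: "A = L \<or> A = R" for A
        unfolding vertex_cover_def
      proof (intro conjI ballI)
        show "finite (C1 \<inter> C2 \<union> A \<inter> W)" using fin unfolding W_def by auto
        fix f assume f: "f \<in> E"
        then obtain u v where uv: "u \<in> L" "v \<in> R" "f = {u, v}"
          using psubset.prems unfolding bipartite_graph_def by blast
        have c1: "f \<noteq> e1 \<Longrightarrow> f \<inter> C1 \<noteq> {}" and c2: "f \<noteq> e2 \<Longrightarrow> f \<inter> C2 \<noteq> {}"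
          using f 1 2 unfolding vertex_cover_def by auto
        \<comment> \<open>An edge other than \<open>e1\<close> and \<open>e2\<close> meets both
          \<open>C1\<close> and \<open>C2\<close>; if it misses \<open>C1 \<inter> C2\<close>, its
          endpoints lie in \<open>C1 - C2\<close> and \<open>C2 - C1\<close>. Each of
          \<open>e1\<close> and \<open>e2\<close> consists of \<open>x\<close> and a vertex of
          \<open>D\<close>.\<close>
        have "f \<subseteq> W \<or> f \<inter> (C1 \<inter> C2) \<noteq> {}"
        proof (cases "f = e1 \<or> f = e2")
          case True
          then show ?thesis using c1 c2 e False x uv unfolding W_def D_def by auto
        next
          case False
          then show ?thesis using c1 c2 uv unfolding W_def D_def by auto
        qed
        then show "f \<inter> (C1 \<inter> C2 \<union> A \<inter> W) \<noteq> {}" using uv A by auto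
      qed
      have "card C1 = card (C1 - C2) + card (C1 \<inter> C2)"
        using card_Diff_subset_Int[of C1 C2] card_mono[of C1 "C1 \<inter> C2"] fin by simp
      moreover have "card C2 = card (C2 - C1) + card (C1 \<inter> C2)"
        using card_Diff_subset_Int[of C2 C1] card_mono[of C2 "C1 \<inter> C2"] fin
        by (simp add: Int_commute)
      moreover have "card W = Suc (card (C1 - C2) + card (C2 - C1))"
      proof -
        have "card D = card (C1 - C2) + card (C2 - C1)"
          unfolding D_def using fin by (intro card_Un_disjoint) auto
        then show ?thesis unfolding W_def using fin x by (simp add: D_def)
      qed
      moreover have "card (L \<inter> W) + card (R \<inter> W) \<le> card W"
      proof -
        have "card (L \<inter> W) + card (R \<inter> W) = card ((L \<inter> W) \<union> (R \<inter> W))"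
          using psubset.prems fin unfolding W_def bipartite_graph_def
          by (intro card_Un_disjoint[symmetric]) auto
        also have "\<dots> \<le> card W" using fin unfolding W_def by (intro card_mono) auto
        finally show ?thesis .
      qed
      moreover have "card (C1 \<inter> C2 \<union> A \<inter> W) \<le> card (C1 \<inter> C2) + card (A \<inter> W)" for A
        by (rule card_Un_le)
      note this[of L] this[of R]
      moreover note 1(3) 2(3)
      \<comment> \<open>The two covers together have at most \<open>card C1 + card C2 + 1\<close>
        vertices, the 1 being due to \<open>x\<close>. The smaller one thus has at most
        \<open>max (card M1) (card M2)\<close>, since the excess of 1/2 is lost in rounding.\<close>
      ultimately have "card (C1 \<inter> C2 \<union> L \<inter> W) \<le> card M1 \<or> card (C1 \<inter> C2 \<union> L \<inter> W) \<le> card M2 \<or>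
          card (C1 \<inter> C2 \<union> R \<inter> W) \<le> card M1 \<or> card (C1 \<inter> C2 \<union> R \<inter> W) \<le> card M2"
        by linarith
      then show ?thesis using cover 1(1) 2(1) by metis
    qed
  qed
qed

section \<open>Maximum matchings and small covers\<close>

lemma finite_matchings: "finite E \<Longrightarrow> finite {M. matching_in E M}"
  unfolding matching_in_def by (rule finite_subset[of _ "Pow E"]) auto

lemma card_le_\<mu>:
  assumes "finite E" "matching_in E M"
  shows "card M \<le> \<mu> E"
  unfolding \<mu>_def using finite_matchings[OF assms(1)] assms(2) by (intro Max_ge) auto

lemma maximum_matching:
  assumes "finite E"
  obtains M where "matching_in E M" "card M = \<mu> E"
proof -
  have "matching_in E {}" unfolding matching_in_def by simp
  then have "\<mu> E \<in> card ` {M. matching_in E M}"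
    unfolding \<mu>_def using finite_matchings[OF assms] by (intro Max_in) auto
  then show ?thesis using that by auto
qed

lemma minimum_vertex_cover:
  assumes "bipartite_graph L R E"
  obtains C where "vertex_cover E C" "card C \<le> \<mu> E"
  using konig[OF assms] card_le_\<mu>[OF bipartite_graph_finite[OF assms]] le_trans by blast

section \<open>Double counting and the variance of degrees\<close>

text \<open>Both sides add \<open>f w\<close> over all incidences of a vertex in \<open>A\<close>
  with an edge of \<open>X\<close>. Constant \<open>f\<close> counts edges; \<open>f\<close> equal
  to the degree gives the second moment.\<close>

lemma sum_deg_mult:
  fixes f :: "'a \<Rightarrow> real"
  assumes "finite X" "finite A"
  shows "(\<Sum>w\<in>A. f w * real (deg X w)) = (\<Sum>e\<in>X. \<Sum>w\<in>A \<inter> e. f w)"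
proof -
  have "(\<Sum>w\<in>A. f w * real (deg X w)) = (\<Sum>w\<in>A. \<Sum>e\<in>{e \<in> X. w \<in> e}. f w)"
    unfolding deg_def by (simp add: mult.commute)
  also have "\<dots> = (\<Sum>e\<in>X. \<Sum>w\<in>{w \<in> A. w \<in> e}. f w)"
    using assms by (intro sum.swap_restrict)
  finally show ?thesis by (simp add: Int_def)
qed

lemma deg_mono: "finite X \<Longrightarrow> F \<subseteq> X \<Longrightarrow> deg F w \<le> deg X w"
  unfolding deg_def by (intro card_mono) auto

text \<open>Expand the square: by double counting, the quadratic term is at most
  \<open>b * card F\<close> and the linear term is exactly \<open>-2 * b * card F\<close>.\<close>

lemma sum_deg_variance:
  fixes b :: real
  assumes "finite F" "finite W"
    and edge: "\<And>e. e \<in> F \<Longrightarrow> e \<subseteq> W \<and> card e = 2"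
    and bound: "\<And>e. e \<in> F \<Longrightarrow> (\<Sum>w\<in>e. real (deg F w)) \<le> b"
  shows "(\<Sum>w\<in>W. (real (deg F w) - b/2)\<^sup>2) \<le> b\<^sup>2 / 4 * real (card W) - b * real (card F)"
proof -
  have int: "W \<inter> e = e" if "e \<in> F" for e using edge[OF that] by blast
  have "(\<Sum>w\<in>W. real (deg F w) * real (deg F w)) = (\<Sum>e\<in>F. \<Sum>w\<in>e. real (deg F w))"
    using int by (simp add: sum_deg_mult assms(1,2) cong: sum.cong)
  also have "\<dots> \<le> (\<Sum>e\<in>F. b)" using bound by (rule sum_mono)
  finally have sq: "(\<Sum>w\<in>W. real (deg F w) * real (deg F w)) \<le> b * real (card F)"
    by (simp add: mult.commute)
  have "(\<Sum>w\<in>W. b * real (deg F w)) = (\<Sum>e\<in>F. \<Sum>w\<in>e. b)"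
    using int by (simp add: sum_deg_mult assms(1,2) cong: sum.cong)
  also have "\<dots> = 2 * b * real (card F)" using edge by simp
  finally have lin: "(\<Sum>w\<in>W. b * real (deg F w)) = 2 * b * real (card F)" .
  have "(\<Sum>w\<in>W. (real (deg F w) - b/2)\<^sup>2) =
      (\<Sum>w\<in>W. real (deg F w) * real (deg F w) - b * real (deg F w) + b\<^sup>2 / 4)"
    by (intro sum.cong) (auto simp: power2_eq_square field_simps)
  also have "\<dots> = (\<Sum>w\<in>W. real (deg F w) * real (deg F w)) - 2 * b * real (card F)
      + b\<^sup>2 / 4 * real (card W)"
    by (simp add: sum.distrib sum_subtractf lin)
  finally show ?thesis using sq by linarith
qed

text \<open>The degrees over \<open>K\<close> count every edge at least once. Each deviation
  \<open>y\<close> from \<open>b/2\<close> is at most \<open>1/(2*s) + s/2 * y\<^sup>2\<close>; this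
  form of Cauchy-Schwarz avoids the square root and leaves \<open>s\<close> to be chosen.\<close>

lemma card_le_cover_variance:
  fixes b s :: real
  assumes "finite F" "finite W" "b \<ge> 0" "s > 0"
    and sub: "\<And>e. e \<in> F \<Longrightarrow> e \<subseteq> W"
    and K: "vertex_cover F K"
  shows "real (card F) \<le> real (card K) * (b/2 + 1 / (2*s))
           + s/2 * (\<Sum>w\<in>W. (real (deg F w) - b/2)\<^sup>2)"
proof -
  have finK: "finite K" using K unfolding vertex_cover_def by blast
  have "real (card F) = (\<Sum>e\<in>F. 1)" by simp
  also have "\<dots> \<le> (\<Sum>e\<in>F. \<Sum>w\<in>(K \<inter> W) \<inter> e. 1)"
  proof (rule sum_mono)
    fix e assume "e \<in> F"
    then have "(K \<inter> W) \<inter> e \<noteq> {}" using sub K unfolding vertex_cover_def by blast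
    then have "card ((K \<inter> W) \<inter> e) > 0" using finK by (simp add: card_gt_0_iff)
    then show "(1::real) \<le> (\<Sum>w\<in>(K \<inter> W) \<inter> e. 1)" by simp
  qed
  also have "\<dots> = (\<Sum>w\<in>K \<inter> W. 1 * real (deg F w))"
    using assms(1,2) by (intro sum_deg_mult[symmetric]) auto
  also have "\<dots> \<le> (\<Sum>w\<in>K \<inter> W. (b/2 + 1 / (2*s)) + s/2 * (real (deg F w) - b/2)\<^sup>2)"
  proof (rule sum_mono)
    fix w
    define y where "y = real (deg F w) - b/2"
    have "0 \<le> (s * y - 1)\<^sup>2 / (2*s)" using \<open>s > 0\<close> by simp
    also have "\<dots> = 1 / (2*s) + s/2 * y\<^sup>2 - y"
      using \<open>s > 0\<close> by (simp add: power2_eq_square field_simps)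
    finally show "1 * real (deg F w) \<le> (b/2 + 1 / (2*s)) + s/2 * (real (deg F w) - b/2)\<^sup>2"
      unfolding y_def by simp
  qed
  also have "\<dots> = real (card (K \<inter> W)) * (b/2 + 1 / (2*s))
      + s/2 * (\<Sum>w\<in>K \<inter> W. (real (deg F w) - b/2)\<^sup>2)"
    by (simp add: sum.distrib sum_distrib_left)
  also have "\<dots> \<le> real (card K) * (b/2 + 1 / (2*s))
      + s/2 * (\<Sum>w\<in>W. (real (deg F w) - b/2)\<^sup>2)"
    using assms finK
    by (intro add_mono mult_right_mono mult_left_mono sum_mono2) (auto intro: card_mono)
  finally show ?thesis .
qed

text \<open>Disjoint edges that meet \<open>C\<close> select distinct vertices of \<open>C\<close>,
  so at most \<open>card C\<close> edges of \<open>M\<close> meet it.\<close>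

lemma card_matching_le_cover:
  assumes "finite M" "pairwise disjnt M" "finite C"
  shows "card M \<le> card {e \<in> M. e \<inter> C = {}} + card C"
proof -
  let ?P = "{e \<in> M. e \<inter> C \<noteq> {}}"
  define g where "g e = (SOME x. x \<in> e \<inter> C)" for e
  have g: "g e \<in> e \<inter> C" if "e \<in> ?P" for e
    unfolding g_def by (rule someI_ex) (use that in blast)
  have "inj_on g ?P"
  proof (rule inj_onI)
    fix e f assume ef: "e \<in> ?P" "f \<in> ?P" "g e = g f"
    then have "\<not> disjnt e f" using g[of e] g[of f] unfolding disjnt_def by auto
    then show "e = f" using ef assms(2) unfolding pairwise_def by blast
  qed
  then have "card ?P \<le> card C" using g assms(3) by (intro card_inj_on_le[of g]) auto
  moreover have "card M = card ({e \<in> M. e \<inter> C = {}} \<union> ?P)" by (rule arg_cong[of _ _ card]) auto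
  moreover have "card ({e \<in> M. e \<inter> C = {}} \<union> ?P) = card {e \<in> M. e \<inter> C = {}} + card ?P"
    using assms(1) by (intro card_Un_disjoint) auto
  ultimately show ?thesis by linarith
qed

section \<open>The numerical contradiction\<close>

text \<open>
  The value \<open>4 / (b * \<delta>)\<close> of \<open>s\<close> in \<open>card_le_cover_variance\<close> balances its two error terms in the
  extreme case \<open>k = 2/3 * n\<close>, \<open>V = b\<^sup>2 * \<delta>\<^sup>2 / 24 * n\<close>.
\<close>

lemma cover_numerics:
  fixes n c k t m V b lam \<delta> :: real
  assumes lam: "0 < lam" "lam < 1/2" and \<delta>: "0 < \<delta>" "\<delta> < 1" and "0 < b" "0 \<le> n" "0 \<le> k"
    and t: "n \<le> t + c" and m: "t * ((1 - lam) * b) \<le> m"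
    and V: "0 \<le> V" "V \<le> b\<^sup>2 / 4 * (2 * t + c) - b * m"
    and k_ge: "m \<le> k * (b/2 + 1 / (2 * (4 / (b * \<delta>)))) + 4 / (b * \<delta>) / 2 * V"
    and c: "c < (1 - 2 * lam) * (2/3 + \<delta>\<^sup>2 / 18) * n"
  shows "k \<ge> (1 - 4 * lam) * (2/3 - \<delta>) * n"
proof (rule ccontr)
  assume "\<not> ?thesis"
  then have k: "k < (1 - 4 * lam) * (2/3 - \<delta>) * n" by simp
  define \<epsilon> where "\<epsilon> = \<delta>\<^sup>2 / 18"
  have eps: "0 < \<epsilon>" using \<delta> unfolding \<epsilon>_def by simp
  \<comment> \<open>Dividing by powers of \<open>b\<close> makes all inequalities
    scale-free.\<close>
  define m' where "m' = m / b"
  define V' where "V' = V / b\<^sup>2"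
  have mb: "m = m' * b" and Vb: "V = V' * b\<^sup>2" using \<open>0 < b\<close> by (auto simp: m'_def V'_def)
  have n: "0 < n" using k \<open>0 \<le> n\<close> \<open>0 \<le> k\<close> by (cases "n = 0") auto
  have V'0: "0 \<le> V'" using V(1) unfolding V'_def by simp
  have m': "t * (1 - lam) \<le> m'"
    using m \<open>0 < b\<close> unfolding m'_def by (simp add: field_simps)
  have V'1: "V' \<le> (2 * t + c) / 4 - m'"
  proof -
    have "V' * b\<^sup>2 \<le> ((2 * t + c) / 4 - m') * b\<^sup>2"
      using V(2) unfolding mb Vb by (simp add: algebra_simps power2_eq_square)
    then show ?thesis using \<open>0 < b\<close> by simp
  qed
  have k': "m' \<le> k / 2 + k * \<delta> / 8 + 2 * V' / \<delta>"
  proof -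
    have "k * (b/2 + 1 / (2 * (4 / (b * \<delta>)))) + 4 / (b * \<delta>) / 2 * V
        = (k / 2 + k * \<delta> / 8 + 2 * V' / \<delta>) * b"
      using \<open>0 < b\<close> \<delta> unfolding Vb by (simp add: field_simps power2_eq_square)
    then show ?thesis using k_ge \<open>0 < b\<close> unfolding mb by simp
  qed
  have "(1/2 - lam) * (n - c) \<le> (1/2 - lam) * t"
    using t lam by (intro mult_left_mono) auto
  moreover have "V' \<le> c / 4 - (1/2 - lam) * t"
    using V'1 m' by (simp add: algebra_simps)
  ultimately have "V' \<le> c / 4 - (1/2 - lam) * (n - c)" by linarith
  also have "\<dots> = c * (3/4 - lam) - (1/2 - lam) * n" by (simp add: field_simps)
  also have "\<dots> < (1 - 2 * lam) * (2/3 + \<epsilon>) * n * (3/4 - lam) - (1/2 - lam) * n"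
    using c lam unfolding \<epsilon>_def by simp
  also have "\<dots> = (1 - 2 * lam) * n * (3/4 * \<epsilon> - lam * (2/3 + \<epsilon>))"
    by (simp add: field_simps)
  finally have V'2: "V' < (1 - 2 * lam) * n * (3/4 * \<epsilon> - lam * (2/3 + \<epsilon>))" .
  \<comment> \<open>A variance is nonnegative, so its upper bound must be positive. This makes
    \<open>lam\<close> small compared with 1, and the signs needed below follow.\<close>
  have factor_pos: "0 < 3/4 * \<epsilon> - lam * (2/3 + \<epsilon>)"
  proof (rule zero_less_mult_pos)
    show "0 < (1 - 2 * lam) * n * (3/4 * \<epsilon> - lam * (2/3 + \<epsilon>))" using V'0 V'2 by linarith
    show "0 < (1 - 2 * lam) * n" using lam n by simp
  qed
  moreover have "0 < lam * \<epsilon>" using lam eps by simp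
  moreover have "\<epsilon> < 1 / 18" using \<delta> unfolding \<epsilon>_def by (simp add: abs_square_less_1)
  ultimately have lam4: "lam < 1/4" by (simp add: algebra_simps)
  have "0 < (1 - 4 * lam) * n * (2/3 - \<delta>)" using k \<open>0 \<le> k\<close> by (simp add: mult_ac)
  moreover have "0 < (1 - 4 * lam) * n" using lam4 n by simp
  ultimately have "0 < 2/3 - \<delta>" by (rule zero_less_mult_pos)
  then have d23: "\<delta> < 2/3" by simp
  have "(1 - 4 * lam) * ((2/3 - \<delta>) * n) \<le> 1 * ((2/3 - \<delta>) * n)"
    using lam d23 n by (intro mult_right_mono) auto
  then have k2: "k < (2/3 - \<delta>) * n" using k by (simp add: mult.assoc)
  have "(1 - 2 * lam) * n * (3/4 * \<epsilon> - lam * (2/3 + \<epsilon>)) \<le> 1 * n * (3/4 * \<epsilon>)"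
    using lam n eps V'0 V'2 factor_pos
    by (intro mult_mono) auto
  then have "V' \<le> 1 * n * (3/4 * \<epsilon>)" using V'2 by linarith
  then have "V' \<le> \<delta>\<^sup>2 / 24 * n" unfolding \<epsilon>_def by (simp add: mult.commute)
  then have "2 * V' / \<delta> \<le> \<delta> / 12 * n"
    using \<delta> by (simp add: field_simps power2_eq_square)
  moreover have "k * \<delta> / 8 \<le> 2/3 * n * \<delta> / 8"
  proof -
    have "(2/3 - \<delta>) * n \<le> 2/3 * n" using \<delta> n by (intro mult_right_mono) auto
    then show ?thesis using k2 \<delta> by simp
  qed
  \<comment> \<open>The coefficients add up to 1/3 - \<delta>/2 + \<delta>/12 + \<delta>/12.\<close>
  ultimately have upper: "m' < (1/3 - \<delta> / 3) * n"
    using k' k2 by (simp add: algebra_simps)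
  \<comment> \<open>The loss from the factor \<open>1 - lam\<close> is made up for by the factor
    \<open>1 - 2 * lam\<close> in the bound on \<open>c\<close>, so the lower bound on
    \<open>m'\<close> is free of \<open>lam\<close>.\<close>
  have "(1/3 - \<epsilon>) * n \<le> (1 - lam) * (1 - (1 - 2 * lam) * (2/3 + \<epsilon>)) * n"
  proof (rule mult_right_mono)
    have "(1 - lam) * (1 - (1 - 2 * lam) * (2/3 + \<epsilon>)) - (1/3 - \<epsilon>)
        = lam * (1 - 4/3 * lam) + \<epsilon> * lam * (3 - 2 * lam)"
      by (simp add: field_simps)
    also have "\<dots> \<ge> 0" using lam eps by simp
    finally show "1/3 - \<epsilon> \<le> (1 - lam) * (1 - (1 - 2 * lam) * (2/3 + \<epsilon>))" by simp
  qed (use n in simp)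
  also have "\<dots> = (1 - lam) * (n - (1 - 2 * lam) * (2/3 + \<epsilon>) * n)" by (simp add: algebra_simps)
  also have "\<dots> \<le> (1 - lam) * t"
    using c t lam unfolding \<epsilon>_def by (intro mult_left_mono) auto
  also have "\<dots> \<le> m'" using m' by (simp add: mult.commute)
  finally have "(1/3 - \<epsilon>) * n < (1/3 - \<delta> / 3) * n" using upper by linarith
  then have "\<delta> / 3 < \<epsilon>" using n by simp
  moreover have "\<delta> * \<delta> \<le> \<delta> * 1" using \<delta> by (intro mult_left_mono) auto
  ultimately show False unfolding \<epsilon>_def using \<delta> by (simp add: power2_eq_square)
qed

section \<open>Covers of \<open>H\<close> and \<open>H \<union> U\<close> compared\<close>

theorem theorem3p1:
  fixes lam \<beta>\<^sub>m \<beta>\<^sub>p :: real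
    and L R :: "'a set" and E H U :: "'a set set"
  assumes "0 < lam" and "lam < 1/2"
    and "\<beta>\<^sub>m \<le> \<beta>\<^sub>p" and "\<beta>\<^sub>p \<ge> 10 / lam" and "\<beta>\<^sub>m \<ge> (1 - lam) * \<beta>\<^sub>p"
    and "bipartite_graph L R E"
    and "H \<subseteq> E"
    and "\<forall>u v. {u, v} \<in> H \<longrightarrow> real (deg H u) + real (deg H v) \<le> \<beta>\<^sub>p"
    and "U = {{u, v} | u v. {u, v} \<in> E \<and> {u, v} \<notin> H \<and> real (deg H u) + real (deg H v) < \<beta>\<^sub>m}"
  shows "\<forall>\<delta>::real. 0 < \<delta> \<and> \<delta> < 1 \<longrightarrow>
           real (\<mu> H) \<ge> (1 - 4 * lam) * (2/3 - \<delta>) * real (\<mu> E) \<or>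
           real (\<mu> (H \<union> U)) \<ge> (1 - 2 * lam) * (2/3 + \<delta>^2 / 18) * real (\<mu> E)"
proof (intro allI impI)
  fix \<delta> :: real
  assume \<delta>: "0 < \<delta> \<and> \<delta> < 1"
  note bip = assms(6)
  have "U \<subseteq> E" using assms(9) by blast
  then have bipHU: "bipartite_graph L R (H \<union> U)" and bipH: "bipartite_graph L R H"
    using bip assms(7) by (auto intro: bipartite_graph_subset)
  have finE: "finite E" and finH: "finite H"
    using bip bipH by (auto intro: bipartite_graph_finite)
  have "0 < 10 / lam" using assms(1) by simp
  then have bpos: "0 < \<beta>\<^sub>p" using assms(4) by linarith
  obtain C where C: "vertex_cover (H \<union> U) C" "card C \<le> \<mu> (H \<union> U)"
    using minimum_vertex_cover[OF bipHU] .
  obtain K where K: "vertex_cover H K" "card K \<le> \<mu> H"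
    using minimum_vertex_cover[OF bipH] .
  obtain M where M: "matching_in E M" "card M = \<mu> E"
    using maximum_matching[OF finE] .
  have ME: "M \<subseteq> E" and disj: "pairwise disjnt M" using M(1) unfolding matching_in_def by auto
  have finM: "finite M" using ME finE by (rule finite_subset)
  have finC: "finite C" using C(1) unfolding vertex_cover_def by blast
  define T where "T = {e \<in> M. e \<inter> C = {}}"
  define S where "S = \<Union>T"
  define F where "F = {e \<in> H. e \<inter> S \<noteq> {}}"
  define W where "W = S \<union> C"
  have card_edge: "card e = 2" if "e \<in> E" for e
    using bipartite_graph_card_edge[OF bip that] .
  have TE: "T \<subseteq> E" and finT: "finite T" and disjT: "pairwise disjnt T"
    using ME finM disj unfolding T_def by (auto intro: pairwise_subset)
  have finedge: "finite e" if "e \<in> E" for e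
    using card_edge[OF that] by (intro card_ge_0_finite) simp
  have finS: "finite S" unfolding S_def using finT TE finedge by blast
  have finF: "finite F" and finW: "finite W"
    using finH finS finC unfolding F_def W_def by auto
  have SC: "S \<inter> C = {}" unfolding S_def T_def by blast
  have FH: "F \<subseteq> H" and FE: "F \<subseteq> E" using assms(7) unfolding F_def by auto

  have F_edge: "\<exists>u v. e = {u, v} \<and> u \<in> S \<and> v \<in> C" if "e \<in> F" for e
  proof -
    obtain a b where "e = {a, b}" using FE \<open>e \<in> F\<close> bip unfolding bipartite_graph_def by blast
    moreover have "e \<inter> S \<noteq> {}" "e \<inter> C \<noteq> {}"
      using that C(1) unfolding F_def vertex_cover_def by auto
    ultimately show ?thesis using SC by auto
  qed
  \<comment> \<open>\<open>F\<close> keeps all edges of \<open>H\<close> at \<open>S\<close>; only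
    degrees outside \<open>S\<close> may drop.\<close>
  have degS: "deg F w = deg H w" if "w \<in> S" for w
    unfolding deg_def F_def using that by (intro arg_cong[of _ _ card]) auto
  have card_S: "real (card S) \<le> 2 * real (card T)"
  proof -
    have "card S \<le> (\<Sum>e\<in>T. card e)" unfolding S_def by (rule card_Union_le_sum_card)
    also have "\<dots> = 2 * card T" using TE card_edge by (simp add: subset_iff)
    finally show ?thesis by linarith
  qed
  have card_W: "real (card W) \<le> 2 * real (card T) + real (card C)"
    using card_Un_le[of S C] card_S unfolding W_def by linarith

  \<comment> \<open>Edges of \<open>T\<close> miss \<open>C\<close>, so they avoid
    \<open>H \<union> U\<close>, and the definition of \<open>U\<close> bounds their degree sums
    from below. As \<open>T\<close> is a matching, these add up to the degree sum over
    \<open>S\<close>, which counts each edge of \<open>F\<close> once, at its only endpoint in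
    \<open>S\<close>.\<close>
  have "real (card T) * ((1 - lam) * \<beta>\<^sub>p) \<le> (\<Sum>e\<in>T. \<Sum>w\<in>e. real (deg H w))"
  proof -
    have "(1 - lam) * \<beta>\<^sub>p \<le> (\<Sum>w\<in>e. real (deg H w))" if e: "e \<in> T" for e
    proof -
      obtain u v where uv: "e = {u, v}" using e TE bip unfolding bipartite_graph_def by blast
      have "u \<noteq> v" using card_edge[of e] e TE uv by auto
      have "e \<notin> H \<union> U" using e C(1) unfolding T_def vertex_cover_def by blast
      then have "\<beta>\<^sub>m \<le> real (deg H u) + real (deg H v)"
        using e TE unfolding assms(9) uv by force
      then show ?thesis using assms(5) \<open>u \<noteq> v\<close> uv by simp
    qed
    then have "(\<Sum>e\<in>T. (1 - lam) * \<beta>\<^sub>p) \<le> (\<Sum>e\<in>T. \<Sum>w\<in>e. real (deg H w))" by (rule sum_mono)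
    then show ?thesis by simp
  qed
  also have "\<dots> = (\<Sum>w\<in>S. real (deg H w))"
    unfolding S_def using disjT TE finedge
    by (subst sum.Union_disjoint) (auto simp: pairwise_def disjnt_def)
  also have "\<dots> = (\<Sum>w\<in>S. 1 * real (deg F w))" using degS by simp
  also have "\<dots> = (\<Sum>e\<in>F. \<Sum>w\<in>S \<inter> e. 1)" by (rule sum_deg_mult[OF finF finS])
  also have "\<dots> = (\<Sum>e\<in>F. 1)"
  proof (rule sum.cong)
    fix e assume "e \<in> F"
    then obtain u v where "e = {u, v}" "u \<in> S" "v \<in> C" using F_edge by blast
    then have "S \<inter> e = {u}" using SC by blast
    then show "(\<Sum>w\<in>S \<inter> e. 1) = (1::real)" by simp
  qed simp
  finally have m: "real (card T) * ((1 - lam) * \<beta>\<^sub>p) \<le> real (card F)" by simp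

  define V where "V = (\<Sum>w\<in>W. (real (deg F w) - \<beta>\<^sub>p/2)\<^sup>2)"
  have "V \<le> \<beta>\<^sub>p\<^sup>2 / 4 * real (card W) - \<beta>\<^sub>p * real (card F)"
    unfolding V_def
  proof (rule sum_deg_variance[OF finF finW])
    fix e assume e: "e \<in> F"
    then obtain u v where uv: "e = {u, v}" "u \<in> S" "v \<in> C" using F_edge by blast
    then have "u \<noteq> v" using SC by blast
    then show "e \<subseteq> W \<and> card e = 2" using uv unfolding W_def by auto
    have "real (deg F u) \<le> real (deg H u)" "real (deg F v) \<le> real (deg H v)"
      using deg_mono[OF finH FH] by auto
    moreover have "real (deg H u) + real (deg H v) \<le> \<beta>\<^sub>p" using e FH uv assms(8) by blast
    ultimately show "(\<Sum>w\<in>e. real (deg F w)) \<le> \<beta>\<^sub>p" using uv \<open>u \<noteq> v\<close> by simp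
  qed
  also have "\<dots> \<le> \<beta>\<^sub>p\<^sup>2 / 4 * (2 * real (card T) + real (card C)) - \<beta>\<^sub>p * real (card F)"
    using card_W by (intro diff_right_mono mult_left_mono) auto
  finally have V: "V \<le> \<beta>\<^sub>p\<^sup>2 / 4 * (2 * real (card T) + real (card C)) - \<beta>\<^sub>p * real (card F)" .
  have V0: "0 \<le> V" unfolding V_def by (intro sum_nonneg) simp
  have "real (card F) \<le> real (card K) * (\<beta>\<^sub>p/2 + 1 / (2 * (4 / (\<beta>\<^sub>p * \<delta>))))
      + 4 / (\<beta>\<^sub>p * \<delta>) / 2 * V"
    unfolding V_def
  proof (rule card_le_cover_variance[OF finF finW])
    show "vertex_cover F K" using K(1) FH unfolding vertex_cover_def by blast
    show "e \<subseteq> W" if "e \<in> F" for e using F_edge[OF that] unfolding W_def by auto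
  qed (use bpos \<delta> in auto)
  moreover have "real (\<mu> E) \<le> real (card T) + real (card C)"
    using card_matching_le_cover[OF finM disj finC] M(2) unfolding T_def by linarith
  \<comment> \<open>If \<open>card C\<close> is not below this threshold, the second alternative
    holds already.\<close>
  ultimately have "real (card C) < (1 - 2 * lam) * (2/3 + \<delta>\<^sup>2 / 18) * real (\<mu> E) \<Longrightarrow>
      (1 - 4 * lam) * (2/3 - \<delta>) * real (\<mu> E) \<le> real (card K)"
    using cover_numerics[of lam \<delta> \<beta>\<^sub>p "real (\<mu> E)" "real (card K)" "real (card T)" "real (card C)"
        "real (card F)" V] assms(1,2) \<delta> bpos m V0 V by simp
  then show "real (\<mu> H) \<ge> (1 - 4 * lam) * (2/3 - \<delta>) * real (\<mu> E) \<or>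
      real (\<mu> (H \<union> U)) \<ge> (1 - 2 * lam) * (2/3 + \<delta>^2 / 18) * real (\<mu> E)"
    using C(2) K(2) by linarith
qed

end
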